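(* Let $\alpha\in(0,1)$ be irrational with continued fraction expansion $\alpha=[a_1,a_2,a_3,\ldots]$, and suppose $\limsup_{n\to\infty} a_n \neq 2$. Then for every real $\lambda\neq 0$ and every $\theta\in[0,1)$, the operator $H_{\lambda,\alpha,\theta}$ has empty point spectrum (i.e. it has no eigenvalues with eigenvector in $\ell^2(\mathbb Z)$).
   Context: For $\lambda\in\mathbb R$, irrational $\alpha\in(0,1)$ and $\theta\in[0,1)$, the Sturmian sequence is $v_{\alpha,\theta}(n)=\chi_{[1-\alpha,1)}(n\alpha+\theta \bmod 1)$, $n\in\mathbb Z$, and $H_{\lambda,\alpha,\theta}$ is the bounded self-adjoint operator on $\ell^2(\mathbb Z)$ given by $(H_{\lambda,\alpha,\theta}u)(n)=u(n+1)+u(n-1)+\lambda v_{\alpha,\theta}(n)u(n)$. The continued fraction expansion is $\alpha=1/(a_1+1/(a_2+1/(a_3+\cdots)))$ with uniquely determined $a_n\in\mathbb N=\{1,2,\ldots\}$. *)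

theory Defs
  imports "HOL-Analysis.Analysis" "HOL-Library.Liminf_Limsup" "HOL-Library.Extended_Real"
begin

definition sturmian :: "real \<Rightarrow> real \<Rightarrow> int \<Rightarrow> real" where
  "sturmian \<alpha> \<theta> n =
     (if 1 - \<alpha> \<le> frac (of_int n * \<alpha> + \<theta>) \<and> frac (of_int n * \<alpha> + \<theta>) < 1 then 1 else 0)"

fun cf_rem :: "real \<Rightarrow> nat \<Rightarrow> real" where
  "cf_rem \<alpha> 0 = \<alpha>"
| "cf_rem \<alpha> (Suc k) = frac (1 / cf_rem \<alpha> k)"

text \<open>Partial quotients a_n (n \<ge> 1) of alpha = [a_1, a_2, ...]: a_n = floor(1/x_{n-1}).\<close>
definition cf_digit :: "real \<Rightarrow> nat \<Rightarrow> nat" where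
  "cf_digit \<alpha> n = nat \<lfloor>1 / cf_rem \<alpha> (n - 1)\<rfloor>"

definition is_eigenvalue_sturmian :: "real \<Rightarrow> real \<Rightarrow> real \<Rightarrow> complex \<Rightarrow> bool" where
  "is_eigenvalue_sturmian lam \<alpha> \<theta> E \<longleftrightarrow>
     (\<exists>u :: int \<Rightarrow> complex.
        (\<lambda>n. (norm (u n))\<^sup>2) summable_on UNIV \<and> u \<noteq> (\<lambda>_. 0) \<and>
        (\<forall>n. u (n + 1) + u (n - 1) + complex_of_real (lam * sturmian \<alpha> \<theta> n) * u n = E * u n))"

end

theory Submission
  imports Defs
begin

text \<open>Let \<open>u\<close> be a square-summable solution, \<open>p\<close> a maximum of \<open>\<bar>u\<bar>\<close>, and \<open>q\<^sub>n\<close> the denominators of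
  the convergents. Where the potential contains a square of block length \<open>q\<^sub>n\<close> centred at \<open>x\<close>, the
  Cayley--Hamilton theorem gives \<open>u (x + q\<^sub>n) + u (x - q\<^sub>n) = t\<^sub>n u x\<close>, where \<open>t\<^sub>n\<close> is the trace of
  the transfer matrix over one block, which depends on \<open>n\<close> only. The square exists unless the orbit
  visits a certain interval of length \<open>\<bar>q\<^sub>n \<alpha> - p\<^sub>n\<bar>\<close> during the block before \<open>x\<close>.

  If \<open>x = p\<close>, then \<open>\<bar>t\<^sub>n\<bar> \<le> 2\<close> because \<open>\<bar>u\<bar>\<close> is maximal at \<open>p\<close>. For two consecutive \<open>n\<close> at least
  one has such a square, and the trace recursion with its Fricke invariant then bounds all
  traces. If the square starts or ends at \<open>p\<close>, that is, \<open>x = p \<plusminus> q\<^sub>n\<close>, then \<open>u p\<close> is bounded by a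
  multiple of values of \<open>u\<close> far away, so this happens for finitely many \<open>n\<close> only. But two visits to the
  interval are at least \<open>q\<^sub>n\<^sub>+\<^sub>1\<close> apart, which yields such a square whenever \<open>a\<^sub>n\<^sub>+\<^sub>1 \<ge> 3\<close>; and if almost all
  digits are \<open>1\<close>, squares starting at \<open>p\<close> occur infinitely often. So the upper limit of the digits is \<open>2\<close>.\<close>

section \<open>Transfer matrices\<close>

definition step_matrix :: "real \<Rightarrow> real \<Rightarrow> real^2^2" where
  "step_matrix E c = vector [vector [E - c, - 1], vector [1, 0]]"

primrec transfer :: "real \<Rightarrow> (int \<Rightarrow> real) \<Rightarrow> int \<Rightarrow> nat \<Rightarrow> real^2^2" where
  "transfer E V i 0 = mat 1"
| "transfer E V i (Suc k) = step_matrix E (V (i + int k)) ** transfer E V i k"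

lemma step_matrix_nth [simp]:
  "step_matrix E c $ 1 $ 1 = E - c" "step_matrix E c $ 1 $ 2 = - 1"
  "step_matrix E c $ 2 $ 1 = 1" "step_matrix E c $ 2 $ 2 = 0"
  by (simp_all add: step_matrix_def)

lemma det_transfer: "det (transfer E V i k) = 1"
proof (induction k)
  case (Suc k)
  have "det (step_matrix E c) = 1" for c
    by (simp add: det_2)
  with Suc show ?case
    by (simp add: det_mul)
qed simp

lemma transfer_add:
  "transfer E V i (k + l) = transfer E V (i + int k) l ** transfer E V i k"
  by (induction l) (simp_all add: matrix_mul_assoc add.assoc)

lemma transfer_Suc_left:
  "transfer E V i (Suc k) = transfer E V (i + 1) k ** step_matrix E (V i)"
  using transfer_add[of E V i 1 k] by simp

lemma transfer_cong:
  assumes "\<And>j. 0 \<le> j \<Longrightarrow> j < int k \<Longrightarrow> V (i + j) = V' (i' + j)"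
  shows "transfer E V i k = transfer E V' i' k"
  using assms by (induction k) simp_all

text \<open>Moving the window by one site conjugates the matrix of a period, which leaves its trace
  unchanged.\<close>

lemma trace_transfer_periodic:
  assumes "\<And>j. V (j + int q) = V j"
  shows "trace (transfer E V i q) = trace (transfer E V i' q)"
proof (cases q)
  case (Suc k)
  have shift: "trace (transfer E V i q) = trace (transfer E V (i + 1) q)" for i
  proof -
    have "trace (transfer E V i q) = trace (step_matrix E (V i) ** transfer E V (i + 1) k)"
      unfolding Suc transfer_Suc_left by (rule trace_mul_sym)
    also have "V i = V (i + 1 + int k)"
      using assms[of i] by (simp add: Suc add.assoc)
    finally show ?thesis
      by (simp add: Suc)
  qed
  have "trace (transfer E V i q) = trace (transfer E V 0 q)" for i
  proof (induction i rule: int_induct[where k = 0])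
    case (step1 i)
    then show ?case using shift[of i] by simp
  next
    case (step2 i)
    then show ?case using shift[of "i - 1"] by simp
  qed simp
  then show ?thesis
    by metis
qed simp

definition schrodinger :: "real \<Rightarrow> (int \<Rightarrow> real) \<Rightarrow> (int \<Rightarrow> real) \<Rightarrow> bool" where
  "schrodinger E V u \<longleftrightarrow> (\<forall>n. u (n + 1) + u (n - 1) + V n * u n = E * u n)"

lemma schrodinger_transfer:
  assumes "schrodinger E V u"
  shows "u (i + int k) = transfer E V i k $ 1 $ 1 * u i + transfer E V i k $ 1 $ 2 * u (i - 1) \<and>
         u (i + int k - 1) = transfer E V i k $ 2 $ 1 * u i + transfer E V i k $ 2 $ 2 * u (i - 1)"
proof (induction k)
  case 0
  show ?case by (simp add: mat_def)
next
  case (Suc k)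
  have "u (i + int k + 1) = (E - V (i + int k)) * u (i + int k) - u (i + int k - 1)"
    using assms[unfolded schrodinger_def, rule_format, of "i + int k"] by (simp add: algebra_simps)
  moreover have "i + int (Suc k) = i + int k + 1" by simp
  ultimately show ?case
    using Suc by (simp add: matrix_matrix_mult_def sum_2 algebra_simps)
qed

text \<open>The scalar form of the Cayley--Hamilton identity needs one site less on either side than
  its vector form: no condition is put on the values of \<open>V\<close> at \<open>x - q\<close> and \<open>x + q\<close>.\<close>

lemma schrodinger_square:
  assumes u: "schrodinger E V u" and q: "q \<ge> 1"
    and per: "\<And>j. x - int q < j \<Longrightarrow> j < x \<Longrightarrow> V (j + int q) = V j"
  shows "u (x + int q) + u (x - int q) = trace (transfer E V (x - int q + 1) q) * u x"
proof -
  define s where "s = x - int q + 1"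
  \<comment> \<open>\<open>N\<close> belongs to the \<open>q - 1\<close> sites strictly between
    \<open>x - q\<close> and \<open>x\<close>; by \<open>per\<close> it also belongs to those
    strictly between \<open>x\<close> and \<open>x + q\<close>.\<close>
  define N where "N = transfer E V s (q - 1)"
  obtain k where k: "q = Suc k" using q by (cases q) auto
  have N': "N = transfer E V (x + 1) (q - 1)"
    unfolding N_def
  proof (rule transfer_cong)
    fix j assume "0 \<le> j" "j < int (q - 1)"
    then show "V (s + j) = V (x + 1 + j)"
      using per[of "s + j"] by (simp add: s_def k add_ac)
  qed
  have x: "s + int k = x" "s - 1 = x - int q" "x + 1 + int k = x + int q"
    by (simp_all add: s_def k)
  have tr: "trace (transfer E V s q) = (E - V x) * N $ 1 $ 1 - N $ 2 $ 1 + N $ 1 $ 2"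
    unfolding N_def k
    by (simp add: trace_def sum_2 matrix_matrix_mult_def x)
  have det: "N $ 1 $ 1 * N $ 2 $ 2 - N $ 1 $ 2 * N $ 2 $ 1 = 1"
    using det_transfer[of E V s "q - 1"] by (simp add: N_def det_2)
  have l: "u x = N $ 1 $ 1 * u s + N $ 1 $ 2 * u (x - int q)"
    "u (x - 1) = N $ 2 $ 1 * u s + N $ 2 $ 2 * u (x - int q)"
    using schrodinger_transfer[OF u, of s k] unfolding x by (simp_all add: N_def k)
  have r: "u (x + int q) = N $ 1 $ 1 * u (x + 1) + N $ 1 $ 2 * u x"
    using schrodinger_transfer[OF u, of "x + 1" k] unfolding x by (simp add: N' k)
  have "u (x - int q) = (N $ 1 $ 1 * N $ 2 $ 2 - N $ 1 $ 2 * N $ 2 $ 1) * u (x - int q)"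
    using det by simp
  also have "\<dots> = N $ 1 $ 1 * u (x - 1) - N $ 2 $ 1 * u x"
    unfolding l by (simp add: algebra_simps)
  finally have "u (x + int q) + u (x - int q) =
      N $ 1 $ 1 * (u (x + 1) + u (x - 1)) + (N $ 1 $ 2 - N $ 2 $ 1) * u x"
    using r by (simp add: algebra_simps)
  also have "u (x + 1) + u (x - 1) = (E - V x) * u x"
    using u[unfolded schrodinger_def, rule_format, of x] by (simp add: algebra_simps)
  finally show ?thesis
    unfolding s_def[symmetric] tr by (simp add: algebra_simps)
qed

section \<open>Bounded traces\<close>

text \<open>For determinant 1 this is the trace of the commutator of \<open>A\<close> and
  \<open>B\<close> plus 2.\<close>

definition fricke :: "real^2^2 \<Rightarrow> real^2^2 \<Rightarrow> real" where
  "fricke A B = (trace A)\<^sup>2 + (trace B)\<^sup>2 + (trace (A ** B))\<^sup>2 - trace A * trace B * trace (A ** B)"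

definition mpow :: "real^2^2 \<Rightarrow> nat \<Rightarrow> real^2^2" where
  "mpow B k = (((**) B) ^^ k) (mat 1)"

lemma mpow_0 [simp]: "mpow B 0 = mat 1"
  and mpow_Suc: "mpow B (Suc k) = B ** mpow B k"
  by (simp_all add: mpow_def)

lemma mpow_Suc2: "mpow B (Suc k) = mpow B k ** B"
  by (induction k) (simp_all add: mpow_Suc matrix_mul_assoc)

lemma trace_mpow_rec:
  fixes B :: "real^2^2"
  assumes "det B = 1"
  shows "trace (A ** mpow B (Suc (Suc k))) = trace B * trace (A ** mpow B (Suc k)) - trace (A ** mpow B k)"
proof -
  have "trace (X ** B ** B) = trace B * trace (X ** B) - det B * trace X" for X :: "real^2^2"
    by (simp add: trace_def det_2 matrix_matrix_mult_def sum_2 algebra_simps)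
  from this[of "A ** mpow B k"] assms show ?thesis
    by (simp add: mpow_Suc2 matrix_mul_assoc)
qed

text \<open>The recursion of \<open>trace_mpow_rec\<close> preserves the quadratic form on the left,
  so its value at \<open>k = 0\<close> persists.\<close>

lemma trace_mpow_quadratic:
  fixes A B :: "real^2^2"
  assumes "det B = 1"
  defines "t \<equiv> \<lambda>k. trace (A ** mpow B k)"
  shows "(t k)\<^sup>2 + (t (Suc k))\<^sup>2 - trace B * t k * t (Suc k) = fricke A B - (trace B)\<^sup>2"
proof (induction k)
  case 0
  show ?case by (simp add: t_def fricke_def mpow_Suc)
next
  case (Suc k)
  have rec: "t (Suc (Suc k)) = trace B * t (Suc k) - t k"
    unfolding t_def using assms(1) by (rule trace_mpow_rec)
  show ?case
    using Suc unfolding rec by (simp add: power2_eq_square algebra_simps)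
qed

text \<open>By cyclicity the pair of traces in \<open>trace_mpow_quadratic\<close> consists of those
  of \<open>A B^k\<close> and \<open>B A B^k\<close>. The invariant is therefore constant along the
  recursion of the word matrices.\<close>

lemma fricke_mpow:
  assumes "det B = 1"
  shows "fricke B (A ** mpow B k) = fricke A B"
proof -
  have "trace (B ** (A ** mpow B k)) = trace (A ** mpow B (Suc k))"
    using trace_mul_sym[of B "A ** mpow B k"] by (simp add: mpow_Suc2 matrix_mul_assoc)
  then show ?thesis
    using trace_mpow_quadratic[OF assms, of A k] by (simp add: fricke_def algebra_simps)
qed

text \<open>If the trace of \<open>B\<close> is large, then \<open>\<lambda>k. \<bar>trace (A B\<^sup>k)\<bar>\<close> is convex, so that the bound at
  \<open>0\<close> and \<open>a\<close> is inherited by \<open>k = 1\<close>, and the invariant then controls the trace of \<open>B\<close>.\<close>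

lemma trace_bound_from_neighbours:
  fixes A B :: "real^2^2"
  assumes det: "det B = 1" and a: "a \<ge> 1"
    and A: "\<bar>trace A\<bar> \<le> 2" and C: "\<bar>trace (A ** mpow B a)\<bar> \<le> 2"
  shows "\<bar>trace B\<bar> \<le> 4 + \<bar>fricke A B\<bar>"
proof (rule ccontr)
  define t where "t k = trace (A ** mpow B k)" for k
  define x where "x = trace B"
  define K where "K = fricke A B"
  assume "\<not> ?thesis"
  then have x: "\<bar>x\<bar> > 4 + \<bar>K\<bar>" by (simp add: x_def K_def)
  have "\<bar>x\<bar> * (\<bar>x\<bar> - 4) \<ge> 4 * \<bar>K\<bar> + 0"
    using x by (intro order_trans[OF _ mult_mono[of 4 "\<bar>x\<bar>" "\<bar>K\<bar>" "\<bar>x\<bar> - 4"]]) auto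
  moreover have "\<bar>x\<bar> * (\<bar>x\<bar> - 4) > \<bar>K\<bar>"
    using mult_strict_mono[of 1 "\<bar>x\<bar>" "\<bar>K\<bar>" "\<bar>x\<bar> - 4"] x by auto
  \<comment> \<open>The margin \<open>4 * \<bar>x\<bar>\<close> is the most that
    \<open>\<bar>x * t 0 * t 1\<bar>\<close> can reach once both traces are at most 2 in absolute
    value.\<close>
  ultimately have big: "x\<^sup>2 > K + 4 * \<bar>x\<bar>"
    by (simp add: power2_eq_square algebra_simps flip: abs_mult)
  have quad: "(t k)\<^sup>2 + (t (Suc k))\<^sup>2 - x * t k * t (Suc k) = K - x\<^sup>2" for k
    unfolding t_def x_def K_def using det by (rule trace_mpow_quadratic)
  have pos: "x * t k * t (Suc k) > 0" for k
    using quad[of k] big by (smt (verit) zero_le_power2 abs_ge_zero)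
  have rec: "t (Suc (Suc k)) = x * t (Suc k) - t k" for k
    unfolding t_def x_def using det by (rule trace_mpow_rec)
  have convex: "\<bar>t (Suc (Suc k))\<bar> + \<bar>t k\<bar> \<ge> 2 * \<bar>t (Suc k)\<bar>" for k
  proof -
    have "x * t (Suc k) * t k > 0" "x * t (Suc k) * t (Suc (Suc k)) > 0"
      using pos[of k] pos[of "Suc k"] by (simp_all add: mult_ac)
    then have "\<bar>t (Suc (Suc k))\<bar> + \<bar>t k\<bar> = \<bar>t (Suc (Suc k)) + t k\<bar>"
      unfolding zero_less_mult_iff[of "x * t (Suc k)"] by auto
    also have "\<dots> = \<bar>x\<bar> * \<bar>t (Suc k)\<bar>"
      by (simp add: rec abs_mult)
    also have "\<dots> \<ge> 2 * \<bar>t (Suc k)\<bar>"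
      using x by (intro mult_right_mono) auto
    finally show ?thesis .
  qed
  have t0: "\<bar>t 0\<bar> \<le> 2" using A by (simp add: t_def)
  have t1: "\<bar>t 1\<bar> \<le> 2"
  proof (rule ccontr)
    \<comment> \<open>By convexity an increase from \<open>\<bar>t 0\<bar>\<close> to
      \<open>\<bar>t 1\<bar>\<close> would continue up to \<open>\<bar>t a\<bar>\<close>, which is
      at most 2.\<close>
    assume "\<not> \<bar>t 1\<bar> \<le> 2"
    then have "\<bar>t (Suc k)\<bar> > 2 \<and> \<bar>t (Suc k)\<bar> \<ge> \<bar>t k\<bar>" for k
    proof (induction k)
      case 0
      then show ?case using t0 by simp
    next
      case (Suc k)
      then show ?case using convex[of k] by auto
    qed
    from this[of "a - 1"] a C show False
      by (simp add: t_def)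
  qed
  have "\<bar>x * t 0 * t 1\<bar> \<le> \<bar>x\<bar> * 2 * 2"
    unfolding abs_mult using t0 t1 by (intro mult_mono) auto
  moreover have "x * t 0 * t 1 \<ge> x\<^sup>2 - K"
    using quad[of 0] by (smt (verit) One_nat_def zero_le_power2)
  ultimately show False
    using big by linarith
qed

text \<open>After level \<open>n0\<close>, a trace exceeding 2 in absolute value has two neighbours
  that do not, by \<open>two\<close>. The resulting bound involves only the invariant, which is the
  same at all levels.\<close>

lemma bounded_traces:
  fixes M :: "nat \<Rightarrow> real^2^2"
  assumes det: "\<And>n. det (M n) = 1" and a: "\<And>n. n \<ge> n0 \<Longrightarrow> a n \<ge> 1"
    and rec: "\<And>n. n \<ge> n0 \<Longrightarrow> M (Suc (Suc n)) = M n ** mpow (M (Suc n)) (a n)"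
    and two: "\<And>n. n \<ge> n0 \<Longrightarrow> \<bar>trace (M n)\<bar> \<le> 2 \<or> \<bar>trace (M (Suc n))\<bar> \<le> 2"
  obtains C where "\<And>n. n > n0 \<Longrightarrow> \<bar>trace (M n)\<bar> \<le> C"
proof -
  have inv: "fricke (M n) (M (Suc n)) = fricke (M n0) (M (Suc n0))" if "n \<ge> n0" for n
    using that
  proof (induction n rule: dec_induct)
    case (step n)
    then show ?case by (simp add: rec fricke_mpow det)
  qed simp
  have "\<bar>trace (M n)\<bar> \<le> 4 + \<bar>fricke (M n0) (M (Suc n0))\<bar>" if n: "n > n0" for n
  proof (cases "\<bar>trace (M n)\<bar> \<le> 2")
    case False
    obtain m where m: "n = Suc m" "m \<ge> n0" using n by (cases n) auto
    have "\<bar>trace (M m)\<bar> \<le> 2" "\<bar>trace (M (Suc n))\<bar> \<le> 2"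
      using two[of m] two[of n] False m by auto
    then show ?thesis
      using trace_bound_from_neighbours[OF det[of n] a[OF m(2)], of "M m"] rec[OF m(2)] inv[OF m(2)] m
      by simp
  qed simp
  then show thesis by (rule that)
qed

section \<open>Sturmian words and rational rotations\<close>

lemma sturmian_eq_floor_diff:
  assumes "0 < \<alpha>" "\<alpha> < 1"
  shows "sturmian \<alpha> \<theta> n = of_int (\<lfloor>of_int (n + 1) * \<alpha> + \<theta>\<rfloor> - \<lfloor>of_int n * \<alpha> + \<theta>\<rfloor>)"
proof -
  define x where "x = of_int n * \<alpha> + \<theta>"
  have "\<lfloor>x + \<alpha>\<rfloor> = (if 1 - \<alpha> \<le> frac x then \<lfloor>x\<rfloor> + 1 else \<lfloor>x\<rfloor>)"
    using assms frac_lt_1[of x] unfolding frac_def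
    by (auto intro!: floor_unique) linarith
  moreover have "of_int (n + 1) * \<alpha> + \<theta> = x + \<alpha>"
    by (simp add: x_def algebra_simps)
  ultimately show ?thesis
    by (simp add: sturmian_def frac_lt_1 flip: x_def)
qed

text \<open>Position \<open>m\<close> is regular if the orbit does not cross an integer when the angle \<open>q \<alpha> - P\<close>
  is added. The word can fail to repeat after \<open>q\<close> steps only next to irregular positions.\<close>

definition regular :: "real \<Rightarrow> real \<Rightarrow> nat \<Rightarrow> int \<Rightarrow> int \<Rightarrow> bool" where
  "regular \<alpha> \<theta> q P m \<longleftrightarrow> \<lfloor>of_int (m + int q) * \<alpha> + \<theta>\<rfloor> = \<lfloor>of_int m * \<alpha> + \<theta>\<rfloor> + P"

lemma sturmian_repeat:
  assumes "0 < \<alpha>" "\<alpha> < 1" "regular \<alpha> \<theta> q P j" "regular \<alpha> \<theta> q P (j + 1)"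
  shows "sturmian \<alpha> \<theta> (j + int q) = sturmian \<alpha> \<theta> j"
  using assms(3,4) unfolding regular_def sturmian_eq_floor_diff[OF assms(1,2)]
  by (simp add: algebra_simps)

lemma not_regularE:
  assumes "\<not> regular \<alpha> \<theta> q P m"
  obtains l :: int where
    "(if of_nat q * \<alpha> \<le> of_int P
      then 0 \<le> of_int m * \<alpha> + \<theta> - of_int l \<and> of_int m * \<alpha> + \<theta> - of_int l < of_int P - of_nat q * \<alpha>
      else of_int P - of_nat q * \<alpha> \<le> of_int m * \<alpha> + \<theta> - of_int l \<and> of_int m * \<alpha> + \<theta> - of_int l < 0)"
proof -
  define x where "x = of_int m * \<alpha> + \<theta>"
  define d where "d = of_nat q * \<alpha> - of_int P"
  have eq: "of_int (m + int q) * \<alpha> + \<theta> = (x + d) + of_int P"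
    by (simp add: x_def d_def algebra_simps)
  have ne: "\<lfloor>x + d\<rfloor> \<noteq> \<lfloor>x\<rfloor>"
    using assms unfolding regular_def eq floor_add_int[symmetric] by (simp add: x_def)
  have "if d \<le> 0 then 0 \<le> x - of_int \<lfloor>x\<rfloor> \<and> x - of_int \<lfloor>x\<rfloor> < - d
     else - d \<le> x - of_int \<lfloor>x + d\<rfloor> \<and> x - of_int \<lfloor>x + d\<rfloor> < 0"
  proof (cases "d \<le> 0")
    case True
    then have "\<lfloor>x + d\<rfloor> < \<lfloor>x\<rfloor>" using ne by (simp add: floor_mono order_less_le)
    then show ?thesis using True by (auto simp: floor_less_iff)
  next
    case False
    then have "\<lfloor>x\<rfloor> < \<lfloor>x + d\<rfloor>" using ne by (simp add: floor_mono order_less_le)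
    then have "x < of_int \<lfloor>x + d\<rfloor>" by (simp add: floor_less_iff)
    then show ?thesis
      unfolding if_not_P[OF False] using of_int_floor_le[of "x + d"] by (intro conjI; linarith)
  qed
  moreover have "of_nat q * \<alpha> \<le> of_int P \<longleftrightarrow> d \<le> 0" "of_int P - of_nat q * \<alpha> = - d"
    by (simp_all add: d_def)
  ultimately show thesis
    using that[of "if d \<le> 0 then \<lfloor>x\<rfloor> else \<lfloor>x + d\<rfloor>"] unfolding x_def[symmetric] by presburger
qed

text \<open>On a window of regular positions the rotation cannot be told apart from the rotation by
  \<open>P / q\<close>.\<close>

lemma floor_eq_rational_rotation:
  fixes \<alpha> \<theta> :: real
  assumes q: "q \<ge> 1" and reg: "\<And>m. s \<le> m \<Longrightarrow> m < s + int q \<Longrightarrow> regular \<alpha> \<theta> q P m"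
  obtains c where "\<And>m. s \<le> m \<Longrightarrow> m < s + 2 * int q \<Longrightarrow>
    \<lfloor>of_int m * \<alpha> + \<theta>\<rfloor> = (m * P + c) div int q"
proof -
  define F where "F m = \<lfloor>of_int m * \<alpha> + \<theta>\<rfloor>" for m :: int
  \<comment> \<open>Up to the factor \<open>q\<close>, \<open>g\<close> is the deviation of the
    floor from the line of slope \<open>P / q\<close>; regularity makes it periodic.\<close>
  define g where "g m = int q * F m - m * P" for m
  define d where "d = of_nat q * \<alpha> - of_int P"
  have per: "g (m + int q) = g m" if "s \<le> m" "m < s + int q" for m
    using reg[OF that] by (simp add: g_def F_def regular_def algebra_simps)
  have gen: "of_int (g m) - of_int (g m') < of_nat q + of_int (m - m') * d" for m m'
  proof -
    have "of_int (F m) - of_int (F m') < of_int (m - m') * \<alpha> + 1"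
      unfolding F_def by (simp add: algebra_simps) linarith
    then have "of_nat q * (of_int (F m) - of_int (F m')) < of_nat q * (of_int (m - m') * \<alpha> + 1)"
      using q by (intro mult_strict_left_mono) auto
    then show ?thesis
      by (simp add: g_def d_def algebra_simps)
  qed
  have close: "g m < int q + g m'" if m: "s \<le> m" "m < s + int q" and m': "s \<le> m'" "m' < s + int q" for m m'
  proof -
    \<comment> \<open>Replacing \<open>m\<close> or \<open>m'\<close> by its translate by
      \<open>q\<close> keeps the value of \<open>g\<close> and makes the drift term
      nonpositive.\<close>
    obtain m1 m1' where 1: "g m1 = g m" "g m1' = g m'" and 2: "of_int (m1 - m1') * d \<le> 0"
    proof (cases "of_int (m - m') * d \<le> 0")
      case False
      show thesis
      proof (cases "d > 0")
        case True
        then have "of_int (m - (m' + int q)) * d \<le> 0"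
          using m m' by (intro mult_nonpos_nonneg) linarith+
        then show thesis using that per[OF m'] by blast
      next
        case d: False
        then have "of_int (m + int q - m') * d \<le> 0"
          using m m' by (intro mult_nonneg_nonpos) linarith+
        then show thesis using that per[OF m] by blast
      qed
    qed (use that in blast)
    have "of_int (g m) < (of_int (int q + g m') :: real)"
      using gen[of m1 m1'] 1 2 by simp
    then show ?thesis
      by (simp only: of_int_less_iff)
  qed
  \<comment> \<open>The spread of \<open>g\<close> is less than \<open>q\<close>, so with its
    maximum as offset the remainder \<open>c - g m\<close> lies between 0 and
    \<open>q - 1\<close>.\<close>
  define c where "c = Max (g ` {s..<s + int q})"
  have fin: "finite (g ` {s..<s + int q})" "g ` {s..<s + int q} \<noteq> {}"
    using q by auto
  have c: "F m = (m * P + c) div int q" if m: "s \<le> m" "m < s + int q" for m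
  proof -
    have "g m \<le> c" unfolding c_def using fin m by (intro Max_ge) auto
    moreover have "c \<in> g ` {s..<s + int q}" unfolding c_def using fin by (intro Max_in)
    then have "c < int q + g m" using close m by auto
    ultimately show ?thesis
      using q by (intro int_div_pos_eq[symmetric, where r = "m * P + c - int q * F m"])
        (auto simp: g_def)
  qed
  have "\<lfloor>of_int m * \<alpha> + \<theta>\<rfloor> = (m * P + c) div int q" if m: "s \<le> m" "m < s + 2 * int q" for m
  proof (cases "m < s + int q")
    case True
    then show ?thesis using c[of m] m by (simp add: F_def)
  next
    case False
    define m1 where "m1 = m - int q"
    have m1: "s \<le> m1" "m1 < s + int q" "m = m1 + int q"
      using False m by (auto simp: m1_def)
    have "F m = F m1 + P"
      using reg[OF m1(1,2)] by (simp add: regular_def F_def m1(3))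
    also have "\<dots> = (m1 * P + c + P * int q) div int q"
      using c[OF m1(1,2)] q by simp
    also have "m1 * P + c + P * int q = m * P + c"
      by (simp add: m1(3) algebra_simps)
    finally show ?thesis by (simp add: F_def)
  qed
  then show thesis by (rule that)
qed

definition rational_word :: "nat \<Rightarrow> int \<Rightarrow> int \<Rightarrow> int \<Rightarrow> real" where
  "rational_word q P c j = of_int (((j + 1) * P + c) div int q - (j * P + c) div int q)"

text \<open>Offset and first site are set to 0 as a normalization;
  \<open>trace_transfer_rational_word\<close> shows that for coprime \<open>P\<close> and
  \<open>q\<close> the trace depends on neither.\<close>

definition rational_trace :: "real \<Rightarrow> real \<Rightarrow> nat \<Rightarrow> int \<Rightarrow> real" where
  "rational_trace E lam q P = trace (transfer E (\<lambda>j. lam * rational_word q P 0 j) 0 q)"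

lemma trace_transfer_rational_word:
  assumes q: "q \<ge> 1" and cop: "coprime P (int q)"
  shows "trace (transfer E (\<lambda>j. lam * rational_word q P c j) s q) = rational_trace E lam q P"
proof -
  obtain a b where ab: "a * P + b * int q = 1"
    using bezout_int[of P "int q"] cop by (auto simp: coprime_iff_gcd_eq_1)
  \<comment> \<open>Bezout's identity turns the offset \<open>c\<close> into a translation by
    \<open>c * a\<close> sites, up to the integer \<open>c * b\<close>, which cancels in the
    differences.\<close>
  define h where "h = c * a"
  have shift: "(j * P + c) div int q = ((j + h) * P) div int q + c * b" for j
  proof -
    have "j * P + c = j * P + c * (a * P + b * int q)" by (simp add: ab)
    also have "\<dots> = (j + h) * P + (c * b) * int q" by (simp add: h_def algebra_simps)
    finally show ?thesis using q by simp
  qed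
  have "transfer E (\<lambda>j. lam * rational_word q P c j) s q =
      transfer E (\<lambda>j. lam * rational_word q P 0 j) (s + h) q"
  proof (rule transfer_cong)
    fix j
    have "s + j + h = s + h + j" "s + j + 1 + h = s + h + j + 1" by simp_all
    then show "lam * rational_word q P c (s + j) = lam * rational_word q P 0 (s + h + j)"
      by (simp only: rational_word_def shift) simp
  qed
  moreover have "rational_word q P 0 (j + int q) = rational_word q P 0 j" for j
  proof -
    have "((j + int q) * P) div int q = (j * P) div int q + P" for j
    proof -
      have "(j + int q) * P = j * P + P * int q" by (simp add: algebra_simps)
      then show ?thesis using q by simp
    qed
    from this[of j] this[of "j + 1"] show ?thesis
      by (simp add: rational_word_def add_ac)
  qed
  ultimately show ?thesis
    unfolding rational_trace_def by (simp add: trace_transfer_periodic[of _ q _ "s + h" 0])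
qed

text \<open>The right side contains neither \<open>\<theta>\<close> nor \<open>s\<close>, so traces
  of words with different phases and positions can be compared.\<close>

lemma trace_transfer_regular:
  assumes \<alpha>: "0 < \<alpha>" "\<alpha> < 1" and q: "q \<ge> 1" and cop: "coprime P (int q)"
    and reg: "\<And>m. s \<le> m \<Longrightarrow> m < s + int q \<Longrightarrow> regular \<alpha> \<theta> q P m"
  shows "trace (transfer E (\<lambda>j. lam * sturmian \<alpha> \<theta> j) s q) = rational_trace E lam q P"
proof -
  obtain c where c: "\<And>m. s \<le> m \<Longrightarrow> m < s + 2 * int q \<Longrightarrow>
      \<lfloor>of_int m * \<alpha> + \<theta>\<rfloor> = (m * P + c) div int q"
    using floor_eq_rational_rotation[OF q, of s \<alpha> \<theta> P] reg by metis
  have "transfer E (\<lambda>j. lam * sturmian \<alpha> \<theta> j) s q = transfer E (\<lambda>j. lam * rational_word q P c j) s q"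
  proof (rule transfer_cong)
    fix j assume "0 \<le> j" "j < int q"
    then show "lam * sturmian \<alpha> \<theta> (s + j) = lam * rational_word q P c (s + j)"
      using c[of "s + j"] c[of "s + j + 1"]
      unfolding sturmian_eq_floor_diff[OF \<alpha>] rational_word_def by simp
  qed
  then show ?thesis
    using trace_transfer_rational_word[OF q cop] by simp
qed

text \<open>The \<open>q\<close> regular positions serve twice: they form the window that fixes the
  trace, and their neighbouring pairs give the \<open>q - 1\<close> repetitions required by
  \<open>schrodinger_square\<close>.\<close>

lemma sturmian_square:
  assumes \<alpha>: "0 < \<alpha>" "\<alpha> < 1" and q: "q \<ge> 1" and cop: "coprime P (int q)"
    and reg: "\<And>m. x - int q < m \<Longrightarrow> m \<le> x \<Longrightarrow> regular \<alpha> \<theta> q P m"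
    and u: "schrodinger E (\<lambda>j. lam * sturmian \<alpha> \<theta> j) u"
  shows "u (x + int q) + u (x - int q) = rational_trace E lam q P * u x"
proof -
  have "trace (transfer E (\<lambda>j. lam * sturmian \<alpha> \<theta> j) (x - int q + 1) q) = rational_trace E lam q P"
    by (rule trace_transfer_regular[OF \<alpha> q cop]) (use reg in auto)
  moreover have "lam * sturmian \<alpha> \<theta> (j + int q) = lam * sturmian \<alpha> \<theta> j" if "x - int q < j" "j < x" for j
    using sturmian_repeat[OF \<alpha>, of \<theta> q P j] reg that by simp
  ultimately show ?thesis
    using schrodinger_square[OF u q, of x] by simp
qed

section \<open>Convergents of the rotation number\<close>

lemma Rats_of_inverse_or_frac:
  fixes x :: real
  shows "1 / x \<in> \<rat> \<Longrightarrow> x \<in> \<rat>" "frac x \<in> \<rat> \<Longrightarrow> x \<in> \<rat>"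
proof -
  show "1 / x \<in> \<rat> \<Longrightarrow> x \<in> \<rat>"
    using Rats_inverse[of "1 / x"] by simp
  show "frac x \<in> \<rat> \<Longrightarrow> x \<in> \<rat>"
    using Rats_add[of "frac x" "of_int \<lfloor>x\<rfloor>"] by (simp add: frac_def)
qed

locale irrational_rotation =
  fixes \<alpha> :: real
  assumes \<alpha>: "0 < \<alpha>" "\<alpha> < 1" and irrational: "\<alpha> \<notin> \<rat>"
begin

lemma cf_rem: "0 < cf_rem \<alpha> n \<and> cf_rem \<alpha> n < 1 \<and> cf_rem \<alpha> n \<notin> \<rat>"
proof (induction n)
  case (Suc n)
  then have "1 / cf_rem \<alpha> n \<notin> \<rat>" using Rats_of_inverse_or_frac(1) by blast
  then have "cf_rem \<alpha> (Suc n) \<notin> \<rat>" using Rats_of_inverse_or_frac(2) by auto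
  moreover from this have "cf_rem \<alpha> (Suc n) \<noteq> 0" by (metis Rats_0)
  ultimately show ?case
    using frac_ge_0[of "1 / cf_rem \<alpha> n"] frac_lt_1[of "1 / cf_rem \<alpha> n"] by simp
qed (use \<alpha> irrational in auto)

lemma cf_digit: "real (cf_digit \<alpha> (Suc n)) = 1 / cf_rem \<alpha> n - cf_rem \<alpha> (Suc n)"
  and cf_digit_ge_1: "cf_digit \<alpha> (Suc n) \<ge> 1"
proof -
  define z where "z = \<lfloor>1 / cf_rem \<alpha> n\<rfloor>"
  have "1 / cf_rem \<alpha> n > 1" using cf_rem[of n] by simp
  then have "z \<ge> 1" unfolding z_def by linarith
  moreover have "cf_digit \<alpha> (Suc n) = nat z" by (simp add: cf_digit_def z_def)
  ultimately show "real (cf_digit \<alpha> (Suc n)) = 1 / cf_rem \<alpha> n - cf_rem \<alpha> (Suc n)"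
    and "cf_digit \<alpha> (Suc n) \<ge> 1"
    by (simp_all add: frac_def flip: z_def)
qed

text \<open>Indices are shifted by one against the usual ones: \<open>num n / den n\<close> is the convergent
  \<open>p\<^bsub>n-1\<^esub> / q\<^bsub>n-1\<^esub>\<close>, starting with \<open>p\<^bsub>-1\<^esub> / q\<^bsub>-1\<^esub> = 1 / 0\<close>.\<close>

fun den :: "nat \<Rightarrow> nat" where
  "den 0 = 0"
| "den (Suc 0) = 1"
| "den (Suc (Suc n)) = cf_digit \<alpha> (Suc n) * den (Suc n) + den n"

fun num :: "nat \<Rightarrow> int" where
  "num 0 = 1"
| "num (Suc 0) = 0"
| "num (Suc (Suc n)) = int (cf_digit \<alpha> (Suc n)) * num (Suc n) + num n"

text \<open>By \<open>den_num\<close> this is the absolute value of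
  \<open>den n * \<alpha> - num n\<close>; the product form makes positivity and monotonicity
  immediate.\<close>

definition err :: "nat \<Rightarrow> real" where
  "err n = (\<Prod>k<n. cf_rem \<alpha> k)"

lemma err_pos: "err n > 0"
  unfolding err_def using cf_rem by (intro prod_pos) auto

lemma err_decreasing: "err (Suc n) < err n"
  using err_pos[of n] cf_rem[of n] by (simp add: err_def)

lemma den_num: "of_nat (den n) * \<alpha> - of_int (num n) = - ((- 1) ^ n) * err n"
proof (induction n rule: den.induct)
  case (3 n)
  define x where "x = cf_rem \<alpha> n"
  have x: "x > 0" using cf_rem by (simp add: x_def)
  have "of_nat (den (Suc (Suc n))) * \<alpha> - of_int (num (Suc (Suc n))) =
    real (cf_digit \<alpha> (Suc n)) * (of_nat (den (Suc n)) * \<alpha> - of_int (num (Suc n))) +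
    (of_nat (den n) * \<alpha> - of_int (num n))"
    by (simp add: algebra_simps)
  also have "\<dots> = (1 / x - cf_rem \<alpha> (Suc n)) * ((- 1) ^ n * err n * x) - (- 1) ^ n * err n"
    using 3 by (simp add: cf_digit err_def x_def)
  also have "\<dots> = - ((- 1) ^ n * (err n * x * cf_rem \<alpha> (Suc n)))"
    using x by (simp add: field_simps)
  also have "\<dots> = - ((- 1) ^ Suc (Suc n)) * err (Suc (Suc n))"
    by (simp add: err_def x_def)
  finally show ?case .
qed (simp_all add: err_def)

lemma den_num_det: "int (den n) * num (Suc n) - int (den (Suc n)) * num n = - ((- 1) ^ n)"
  by (induction n) (simp_all add: algebra_simps)

lemma coprime_num_den: "coprime (num n) (int (den n))"
proof (rule coprimeI)
  fix d assume "d dvd num n" "d dvd int (den n)"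
  then have "d dvd int (den n) * num (Suc n) - int (den (Suc n)) * num n" by simp
  then have "d dvd (- 1) ^ n" unfolding den_num_det by simp
  then show "is_unit d" by (rule dvd_trans) (simp add: is_unit_power_iff)
qed

lemma den_ge_1: "n \<ge> 1 \<Longrightarrow> den n \<ge> 1"
proof (induction n rule: den.induct)
  case (3 n)
  then show ?case using cf_digit_ge_1[of n] by (cases "den (Suc n)") auto
qed auto

lemma den_add_le: "den (Suc n) + den n \<le> den (Suc (Suc n))"
  using cf_digit_ge_1[of n] by simp

lemma den_mono: "n \<ge> 1 \<Longrightarrow> den n \<le> den (Suc n)"
  using den_add_le[of "n - 1"] by (cases n) (auto simp del: den.simps(3))

lemma den_less: "n \<ge> 2 \<Longrightarrow> den n < den (Suc n)"
  using den_add_le[of "n - 1"] den_ge_1[of "n - 1"] by (cases n) (auto simp del: den.simps(3))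

lemma den_ge: "n \<le> den (Suc n)"
proof (induction n)
  case (Suc n)
  then show ?case
    using den_less[of "Suc n"] den_ge_1[of "Suc (Suc n)"] by (cases "n = 0") auto
qed simp

lemma den_cf_digit_le: "m * den (Suc n) \<le> den (Suc (Suc n))" if "m \<le> cf_digit \<alpha> (Suc n)"
  unfolding den.simps using mult_le_mono1[OF that] by (rule trans_le_add1)

text \<open>Consecutive convergents form a basis of the lattice \<open>\<int>\<^sup>2\<close>.\<close>

lemma convergent_coordinates:
  obtains A B :: int where "k = A * int (den (Suc n)) + B * int (den n)"
    "(- 1) ^ n * (of_int k * \<alpha> - of_int l) = of_int A * err (Suc n) - of_int B * err n"
proof -
  \<comment> \<open>Cramer's rule: \<open>s\<close> is the determinant of the two convergents and,
    being 1 or -1, its own inverse.\<close>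
  define s :: int where "s = - ((- 1) ^ n)"
  have s: "s * s = 1" by (simp add: s_def flip: power_mult_distrib)
  have det: "int (den n) * num (Suc n) - int (den (Suc n)) * num n = s"
    using den_num_det by (simp add: s_def)
  define A where "A = s * (int (den n) * l - num n * k)"
  define B where "B = s * (k * num (Suc n) - l * int (den (Suc n)))"
  have "A * int (den (Suc n)) + B * int (den n) =
      s * (k * (int (den n) * num (Suc n) - int (den (Suc n)) * num n))"
    by (simp add: A_def B_def algebra_simps)
  then have k: "k = A * int (den (Suc n)) + B * int (den n)"
    using s det by (simp add: mult.left_commute)
  have "A * num (Suc n) + B * num n =
      s * (l * (int (den n) * num (Suc n) - int (den (Suc n)) * num n))"
    by (simp add: A_def B_def algebra_simps)
  then have l: "l = A * num (Suc n) + B * num n"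
    using s det by (simp add: mult.left_commute)
  have "of_int k * \<alpha> - of_int l =
      of_int A * (of_nat (den (Suc n)) * \<alpha> - of_int (num (Suc n))) +
      of_int B * (of_nat (den n) * \<alpha> - of_int (num n))"
    by (simp add: k l algebra_simps)
  also have "\<dots> = (- 1) ^ n * (of_int A * err (Suc n) - of_int B * err n)"
    unfolding den_num by (simp add: algebra_simps)
  finally have "(- 1) ^ n * (of_int k * \<alpha> - of_int l) = of_int A * err (Suc n) - of_int B * err n"
    by (simp add: mult.assoc[symmetric] flip: power_mult_distrib)
  with k show thesis by (rule that)
qed

lemma int_mult_bounds:
  fixes A c :: int and x :: real
  assumes "x > 0"
  shows "c \<le> A \<Longrightarrow> of_int c * x \<le> of_int A * x" "A \<le> c \<Longrightarrow> of_int A * x \<le> of_int c * x"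
  using assms by (auto intro!: mult_right_mono)

abbreviation reg :: "real \<Rightarrow> nat \<Rightarrow> int \<Rightarrow> bool" where
  "reg \<theta> n \<equiv> regular \<alpha> \<theta> (den n) (num n)"

lemma not_regE:
  assumes "\<not> reg \<theta> n m"
  obtains l where "even n \<Longrightarrow> 0 \<le> of_int m * \<alpha> + \<theta> - of_int l \<and> of_int m * \<alpha> + \<theta> - of_int l < err n"
    "odd n \<Longrightarrow> - err n \<le> of_int m * \<alpha> + \<theta> - of_int l \<and> of_int m * \<alpha> + \<theta> - of_int l < 0"
proof -
  have d: "of_nat (den n) * \<alpha> = of_int (num n) - (- 1) ^ n * err n"
    using den_num[of n] by simp
  obtain l where l: "if of_nat (den n) * \<alpha> \<le> of_int (num n)
      then 0 \<le> of_int m * \<alpha> + \<theta> - of_int l \<and>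
        of_int m * \<alpha> + \<theta> - of_int l < of_int (num n) - of_nat (den n) * \<alpha>
      else of_int (num n) - of_nat (den n) * \<alpha> \<le> of_int m * \<alpha> + \<theta> - of_int l \<and>
        of_int m * \<alpha> + \<theta> - of_int l < 0"
    by (rule not_regularE[OF assms])
  show thesis
    by (rule that[of l]; use l err_pos[of n] in \<open>simp add: d\<close>)
qed

text \<open>Modulo 1 both orbit points lie in one interval of length \<open>err n\<close>, so they
  differ by less than \<open>err n\<close>. In lattice coordinates \<open>A \<le> 0\<close> then
  forces \<open>B \<le> 0\<close>, against \<open>m < m'\<close>, while \<open>A \<ge> 1\<close>
  forces \<open>B \<ge> 0\<close>.\<close>

lemma not_reg_gap:
  assumes m: "\<not> reg \<theta> n m" and m': "\<not> reg \<theta> n m'" and less: "m < m'"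
  shows "m' - m \<ge> int (den (Suc n))"
proof -
  obtain l where l: "even n \<Longrightarrow> 0 \<le> of_int m * \<alpha> + \<theta> - of_int l \<and> of_int m * \<alpha> + \<theta> - of_int l < err n"
    "odd n \<Longrightarrow> - err n \<le> of_int m * \<alpha> + \<theta> - of_int l \<and> of_int m * \<alpha> + \<theta> - of_int l < 0"
    using not_regE[OF m] by blast
  obtain l' where l': "even n \<Longrightarrow> 0 \<le> of_int m' * \<alpha> + \<theta> - of_int l' \<and> of_int m' * \<alpha> + \<theta> - of_int l' < err n"
    "odd n \<Longrightarrow> - err n \<le> of_int m' * \<alpha> + \<theta> - of_int l' \<and> of_int m' * \<alpha> + \<theta> - of_int l' < 0"
    using not_regE[OF m'] by blast
  obtain A B where k: "m' - m = A * int (den (Suc n)) + B * int (den n)"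
    and v: "(- 1) ^ n * (of_int (m' - m) * \<alpha> - of_int (l' - l)) = of_int A * err (Suc n) - of_int B * err n"
    by (rule convergent_coordinates)
  have "\<bar>of_int (m' - m) * \<alpha> - of_int (l' - l)\<bar> < err n"
  proof (cases "even n")
    case True
    from l(1)[OF this] l'(1)[OF this] show ?thesis
      unfolding of_int_diff left_diff_distrib by linarith
  next
    case False
    from l(2)[OF this] l'(2)[OF this] show ?thesis
      unfolding of_int_diff left_diff_distrib by linarith
  qed
  then have small: "\<bar>of_int A * err (Suc n) - of_int B * err n\<bar> < err n"
    unfolding v[symmetric] by (simp add: abs_mult power_abs)
  note bd = int_mult_bounds[OF err_pos[of n]] int_mult_bounds[OF err_pos[of "Suc n"]]
  show ?thesis
  proof (cases "A \<ge> 1")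
    case True
    then have "B \<ge> 0"
      using small bd(2)[of B "- 1"] bd(3)[of 1 A] err_pos[of "Suc n"] by (cases "B \<le> - 1") linarith+
    then have "B * int (den n) \<ge> 0" by simp
    then show ?thesis
      unfolding k using mult_right_mono[OF True, of "int (den (Suc n))"] by linarith
  next
    case False
    then have "B \<le> 0"
      using small bd(1)[of 1 B] bd(4)[of A 0] by (cases "B \<ge> 1") auto
    then have "m' - m \<le> 0"
      unfolding k using False by (simp add: add_nonpos_nonpos mult_nonpos_nonneg)
    then show ?thesis using less by simp
  qed
qed

text \<open>The intervals of levels \<open>n\<close> and \<open>n + 1\<close> touch 0 from opposite
  sides, which confines the displacement to one sign and to less than
  \<open>err n + err (n + 1)\<close>. The three alternatives correspond to \<open>A\<close> being
  negative, zero (with \<open>B = 1\<close>) or positive.\<close>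

lemma not_reg_consecutive:
  assumes m: "\<not> reg \<theta> n m" and m': "\<not> reg \<theta> (Suc n) m'"
  shows "m' - m \<le> - int (den (Suc n)) \<or> m' - m = int (den n) \<or> m' - m \<ge> int (den (Suc n)) + int (den n)"
proof -
  obtain l where l: "even n \<Longrightarrow> 0 \<le> of_int m * \<alpha> + \<theta> - of_int l \<and> of_int m * \<alpha> + \<theta> - of_int l < err n"
    "odd n \<Longrightarrow> - err n \<le> of_int m * \<alpha> + \<theta> - of_int l \<and> of_int m * \<alpha> + \<theta> - of_int l < 0"
    using not_regE[OF m] by blast
  obtain l' where l': "odd n \<Longrightarrow> 0 \<le> of_int m' * \<alpha> + \<theta> - of_int l' \<and> of_int m' * \<alpha> + \<theta> - of_int l' < err (Suc n)"
    "even n \<Longrightarrow> - err (Suc n) \<le> of_int m' * \<alpha> + \<theta> - of_int l' \<and> of_int m' * \<alpha> + \<theta> - of_int l' < 0"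
    using not_regE[OF m'] by auto
  obtain A B where k: "m' - m = A * int (den (Suc n)) + B * int (den n)"
    and v: "(- 1) ^ n * (of_int (m' - m) * \<alpha> - of_int (l' - l)) = of_int A * err (Suc n) - of_int B * err n"
    by (rule convergent_coordinates)
  have "0 < of_int B * err n - of_int A * err (Suc n) \<and>
      of_int B * err n - of_int A * err (Suc n) < err n + err (Suc n)"
  proof (cases "even n")
    case True
    then have "of_int (m' - m) * \<alpha> - of_int (l' - l) = of_int A * err (Suc n) - of_int B * err n"
      using v by simp
    with l(1)[OF True] l'(2)[OF True] show ?thesis
      unfolding of_int_diff left_diff_distrib by linarith
  next
    case False
    then have "- (of_int (m' - m) * \<alpha> - of_int (l' - l)) = of_int A * err (Suc n) - of_int B * err n"
      using v by simp
    with l(2)[OF False] l'(1)[OF False] show ?thesis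
      unfolding of_int_diff left_diff_distrib by linarith
  qed
  then have small: "of_int A * err (Suc n) < of_int B * err n"
    "of_int (B - 1) * err n < of_int (A + 1) * err (Suc n)"
    by (simp_all add: algebra_simps)
  note bd = int_mult_bounds[OF err_pos[of n]] int_mult_bounds[OF err_pos[of "Suc n"]]
  show ?thesis
  proof (cases "A \<ge> 0")
    case True
    then have B: "B \<ge> 1"
      using small(1) bd(2)[of B 0] bd(3)[of 0 A] by (cases "B \<le> 0") auto
    show ?thesis
    proof (cases "A = 0")
      case A: True
      then have "B = 1"
        using small(2) bd(1)[of 1 "B - 1"] err_decreasing[of n] B by (cases "B - 1 \<ge> 1") auto
      then show ?thesis using k A by simp
    next
      case False
      then have "A \<ge> 1" using True by simp
      then show ?thesis
        using k B mult_right_mono[of 1 A "int (den (Suc n))"] mult_right_mono[of 1 B "int (den n)"] by simp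
    qed
  next
    case False
    then have "B \<le> 0"
      using small(2) bd(1)[of 0 "B - 1"] bd(4)[of "A + 1" 0] by (cases "B \<ge> 1") auto
    then show ?thesis
      using k False mult_right_mono[of A "- 1" "int (den (Suc n))"] mult_right_mono[of B 0 "int (den n)"] by simp
  qed
qed

text \<open>The argument of \<open>not_reg_gap\<close> started from the orbit point 0. For odd
  \<open>n\<close> position 0 is itself regular, so that lemma does not apply; the weak inequalities
  in \<open>small\<close> cover both parities.\<close>

lemma reg_zero:
  assumes m: "0 < m" "m < int (den (Suc n))"
  shows "reg 0 n m"
proof (rule ccontr)
  assume "\<not> ?thesis"
  then obtain l where l: "even n \<Longrightarrow> 0 \<le> of_int m * \<alpha> + 0 - of_int l \<and> of_int m * \<alpha> + 0 - of_int l < err n"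
    "odd n \<Longrightarrow> - err n \<le> of_int m * \<alpha> + 0 - of_int l \<and> of_int m * \<alpha> + 0 - of_int l < 0"
    using not_regE by blast
  obtain A B where k: "m = A * int (den (Suc n)) + B * int (den n)"
    and v: "(- 1) ^ n * (of_int m * \<alpha> - of_int l) = of_int A * err (Suc n) - of_int B * err n"
    by (rule convergent_coordinates)
  have small: "0 \<le> of_int A * err (Suc n) - of_int B * err n"
    "of_int A * err (Suc n) - of_int B * err n \<le> err n"
    using l unfolding v[symmetric] by (cases "even n"; simp)+
  note bd = int_mult_bounds[OF err_pos[of n]] int_mult_bounds[OF err_pos[of "Suc n"]]
  show False
  proof (cases "A \<ge> 1")
    case True
    then have "B \<ge> 0"
      using small(2) bd(2)[of B "- 1"] bd(3)[of 1 A] err_pos[of "Suc n"] by (cases "B \<le> - 1") linarith+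
    then have "B * int (den n) \<ge> 0" by simp
    then show False
      using k m mult_right_mono[OF True, of "int (den (Suc n))"] by linarith
  next
    case False
    then have "A \<le> 0" by simp
    then have "B \<le> 0"
      using small(1) bd(1)[of 1 B] bd(4)[of A 0] err_pos[of n] by (cases "B \<ge> 1") linarith+
    then show False
      using k m False mult_right_mono[of A 0 "int (den (Suc n))"] mult_right_mono[of B 0 "int (den n)"] by simp
  qed
qed

section \<open>The trace recursion\<close>

definition word_matrix :: "real \<Rightarrow> real \<Rightarrow> nat \<Rightarrow> real^2^2" where
  "word_matrix E lam n = transfer E (\<lambda>j. lam * sturmian \<alpha> 0 j) 1 (den n)"

lemma sturmian_zero_repeat:
  assumes "1 \<le> j" "j + 1 < int (den (Suc n))"
  shows "sturmian \<alpha> 0 (j + int (den n)) = sturmian \<alpha> 0 j"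
  using assms by (intro sturmian_repeat[where P = "num n"] \<alpha> reg_zero) auto

text \<open>At phase 0 the word of length \<open>den (n + 2)\<close> from site 1 on consists of
  \<open>a\<close> copies of the word of length \<open>den (n + 1)\<close> followed by that of
  length \<open>den n\<close>. Matrix products run from right to left.\<close>

lemma word_matrix_rec:
  assumes n: "n \<ge> 2"
  shows "word_matrix E lam (Suc (Suc n)) =
    word_matrix E lam n ** mpow (word_matrix E lam (Suc n)) (cf_digit \<alpha> (Suc n))"
proof -
  define q where "q = den (Suc n)"
  define a where "a = cf_digit \<alpha> (Suc n)"
  define V where "V = (\<lambda>j. lam * sturmian \<alpha> 0 j)"
  \<comment> \<open>This absorbs the strict bound on \<open>j + 1\<close> in
    \<open>sturmian_zero_repeat\<close>.\<close>
  have q: "q \<ge> 2" using den_less[OF n] den_ge_1[of n] n by (simp add: q_def)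
  have len: "den (Suc (Suc n)) = a * q + den n" by (simp add: q_def a_def)
  have per: "V (j + int (i * q)) = V j" if "1 \<le> j" "j + int (i * q) \<le> int (a * q + den n)" for i j
    using that
  proof (induction i)
    case (Suc i)
    have "sturmian \<alpha> 0 (j + int (i * q) + int (den (Suc n))) = sturmian \<alpha> 0 (j + int (i * q))"
    proof (rule sturmian_zero_repeat)
      show "1 \<le> j + int (i * q)" using Suc.prems(1) of_nat_0_le_iff[of "i * q"] by linarith
      show "j + int (i * q) + 1 < int (den (Suc (Suc n)))"
        unfolding len using Suc.prems q by simp
    qed
    moreover have "V (j + int (i * q)) = V j" using Suc by simp
    ultimately show ?case by (simp add: V_def q_def algebra_simps)
  qed simp
  have pow: "transfer E V 1 (i * q) = mpow (transfer E V 1 q) i" if "i \<le> a" for i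
    using that
  proof (induction i)
    case (Suc i)
    have "transfer E V (1 + int (i * q)) q = transfer E V 1 q"
    proof (rule transfer_cong)
      fix j assume j: "0 \<le> j" "j < int q"
      have "Suc i * q \<le> a * q" using Suc.prems by (rule mult_le_mono1)
      then have "int (i * q) + int q \<le> int (a * q)" by (simp flip: of_nat_add of_nat_mult)
      then have "1 + j + int (i * q) \<le> int (a * q + den n)"
        unfolding of_nat_add using j by linarith
      then show "V (1 + int (i * q) + j) = V (1 + j)"
        using per[of "1 + j" i] j by (simp add: add_ac)
    qed
    then show ?case
      using Suc transfer_add[of E V 1 "i * q" q] by (simp add: mpow_Suc add.commute)
  qed simp
  have "transfer E V (1 + int (a * q)) (den n) = transfer E V 1 (den n)"
  proof (rule transfer_cong)
    fix j assume "0 \<le> j" "j < int (den n)"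
    then show "V (1 + int (a * q) + j) = V (1 + j)"
      using per[of "1 + j" a] by (simp add: add_ac)
  qed
  then have "transfer E V 1 (a * q + den n) = transfer E V 1 (den n) ** mpow (transfer E V 1 q) a"
    by (simp add: transfer_add pow)
  then show ?thesis
    unfolding word_matrix_def len by (simp add: V_def q_def a_def)
qed

lemma trace_word_matrix:
  assumes "n \<ge> 2"
  shows "trace (word_matrix E lam n) = rational_trace E lam (den n) (num n)"
  unfolding word_matrix_def
  using den_less[OF assms] den_ge_1[of n] assms
  by (intro trace_transfer_regular \<alpha> coprime_num_den reg_zero) auto

end

section \<open>Decaying solutions\<close>

locale sturmian_solution = irrational_rotation +
  fixes E lam \<theta> :: real and u :: "int \<Rightarrow> real"
  assumes sol: "schrodinger E (\<lambda>j. lam * sturmian \<alpha> \<theta> j) u"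
    and decay: "\<And>\<epsilon>. \<epsilon> > 0 \<Longrightarrow> finite {n. \<bar>u n\<bar> \<ge> \<epsilon>}"
    and nonzero: "\<exists>n. u n \<noteq> 0"
begin

lemma maximum: "\<exists>p. u p \<noteq> 0 \<and> (\<forall>n. \<bar>u n\<bar> \<le> \<bar>u p\<bar>)"
proof -
  obtain n where n: "u n \<noteq> 0" using nonzero by blast
  define S where "S = {m. \<bar>u m\<bar> \<ge> \<bar>u n\<bar>}"
  have S: "finite S" "n \<in> S" using decay[of "\<bar>u n\<bar>"] n by (auto simp: S_def)
  then have "Max ((\<lambda>m. \<bar>u m\<bar>) ` S) \<in> (\<lambda>m. \<bar>u m\<bar>) ` S"
    by (intro Max_in) auto
  then obtain p where p: "p \<in> S" "\<bar>u p\<bar> = Max ((\<lambda>m. \<bar>u m\<bar>) ` S)" by auto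
  have "\<bar>u m\<bar> \<le> \<bar>u p\<bar>" for m
  proof (cases "m \<in> S")
    case True
    then show ?thesis using p(2) S(1) by simp
  next
    case False
    then show ?thesis using p(1) by (simp add: S_def)
  qed
  moreover have "u p \<noteq> 0" using p(1) n by (auto simp: S_def)
  ultimately show ?thesis by blast
qed

definition peak :: int where
  "peak = (SOME p. u p \<noteq> 0 \<and> (\<forall>n. \<bar>u n\<bar> \<le> \<bar>u p\<bar>))"

lemma peak: "u peak \<noteq> 0" "\<bar>u n\<bar> \<le> \<bar>u peak\<bar>"
  using someI_ex[OF maximum] unfolding peak_def by auto

abbreviation tr :: "nat \<Rightarrow> real" where
  "tr n \<equiv> rational_trace E lam (den n) (num n)"

lemma square:
  assumes "n \<ge> 1" "\<And>m. x - int (den n) < m \<Longrightarrow> m \<le> x \<Longrightarrow> reg \<theta> n m"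
  shows "u (x + int (den n)) + u (x - int (den n)) = tr n * u x"
  using assms(2) by (rule sturmian_square[OF \<alpha> den_ge_1[OF assms(1)] coprime_num_den _ sol])

text \<open>A square centred at the peak forces a small trace by the maximum principle. Two
  consecutive levels cannot both fail to have such a square.\<close>

lemma trace_small:
  assumes n: "n \<ge> 1" and reg: "\<And>m. peak - int (den n) < m \<Longrightarrow> m \<le> peak \<Longrightarrow> reg \<theta> n m"
  shows "\<bar>tr n\<bar> \<le> 2"
proof -
  have "\<bar>tr n\<bar> * \<bar>u peak\<bar> = \<bar>u (peak + int (den n)) + u (peak - int (den n))\<bar>"
    using square[OF n reg] by (simp add: abs_mult)
  also have "\<dots> \<le> 2 * \<bar>u peak\<bar>"
    using peak(2)[of "peak + int (den n)"] peak(2)[of "peak - int (den n)"] by linarith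
  finally show ?thesis using peak(1) by simp
qed

lemma trace_small_consecutive:
  assumes n: "n \<ge> 1"
  shows "\<bar>tr n\<bar> \<le> 2 \<or> \<bar>tr (Suc n)\<bar> \<le> 2"
proof (rule ccontr)
  assume "\<not> ?thesis"
  then obtain m m' where
    m: "\<not> reg \<theta> n m" "peak - int (den n) < m" "m \<le> peak" and
    m': "\<not> reg \<theta> (Suc n) m'" "peak - int (den (Suc n)) < m'" "m' \<le> peak"
    using trace_small[OF n] trace_small[of "Suc n"] by auto
  \<comment> \<open>The two windows ending at the peak give
    \<open>- den (n + 1) < m' - m < den n\<close>, which excludes all three alternatives.\<close>
  show False
    using not_reg_consecutive[OF m(1) m'(1)] m m' by linarith
qed

text \<open>The matrix recursion holds for the words of phase 0, whereas small traces come from the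
  peak at phase \<open>\<theta>\<close>; \<open>trace_word_matrix\<close> identifies the two kinds
  of traces.\<close>

lemma trace_bounded:
  obtains C where "\<And>n. n \<ge> 3 \<Longrightarrow> \<bar>tr n\<bar> \<le> C"
proof (rule bounded_traces[where M = "word_matrix E lam" and ?n0.0 = 2 and a = "\<lambda>n. cf_digit \<alpha> (Suc n)"])
  fix C assume C: "\<And>n. n > 2 \<Longrightarrow> \<bar>trace (word_matrix E lam n)\<bar> \<le> C"
  show thesis
    using C trace_word_matrix by (intro that[of C]) force
next
  fix n :: nat
  show "det (word_matrix E lam n) = 1"
    by (simp add: word_matrix_def det_transfer)
  assume n: "n \<ge> 2"
  show "cf_digit \<alpha> (Suc n) \<ge> 1" by (rule cf_digit_ge_1)
  show "word_matrix E lam (Suc (Suc n)) =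
    word_matrix E lam n ** mpow (word_matrix E lam (Suc n)) (cf_digit \<alpha> (Suc n))"
    using n by (rule word_matrix_rec)
  show "\<bar>trace (word_matrix E lam n)\<bar> \<le> 2 \<or> \<bar>trace (word_matrix E lam (Suc n))\<bar> \<le> 2"
    using n trace_small_consecutive[of n] by (simp add: trace_word_matrix)
qed

text \<open>Hence from some level on there is neither a square starting nor a square ending at the
  peak.\<close>

lemma eventually_no_square:
  obtains n0 where "n0 \<ge> 3"
    "\<And>n. n \<ge> n0 \<Longrightarrow> \<exists>m. peak < m \<and> m \<le> peak + int (den n) \<and> \<not> reg \<theta> n m"
    "\<And>n. n \<ge> n0 \<Longrightarrow> \<exists>m. peak - 2 * int (den n) < m \<and> m \<le> peak - int (den n) \<and> \<not> reg \<theta> n m"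
proof -
  obtain C where C: "\<And>n. n \<ge> 3 \<Longrightarrow> \<bar>tr n\<bar> \<le> C" using trace_bounded by blast
  have C0: "C \<ge> 0" using C[of 3] by linarith
  \<comment> \<open>Chosen so that
    \<open>C * \<epsilon> + \<epsilon> < \<bar>u peak\<bar>\<close>.\<close>
  define \<epsilon> where "\<epsilon> = \<bar>u peak\<bar> / (C + 2)"
  have \<epsilon>: "\<epsilon> > 0" using C0 peak(1) by (simp add: \<epsilon>_def)
  obtain R where R: "\<And>m. \<bar>u m\<bar> \<ge> \<epsilon> \<Longrightarrow> \<bar>m\<bar> \<le> R"
    using finite_imageI[OF decay[OF \<epsilon>], of abs] by (intro that[OF Max_ge]) auto
  \<comment> \<open>Since \<open>den n \<ge> n - 1\<close>, for \<open>n \<ge> n0\<close> every site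
    at distance at least \<open>den n\<close> from the peak has absolute value above
    \<open>R\<close>.\<close>
  define n0 where "n0 = nat (\<bar>R\<bar> + \<bar>peak\<bar>) + 3"
  have far: "\<bar>u m\<bar> < \<epsilon>" if "\<bar>m - peak\<bar> \<ge> int (den n)" "n \<ge> n0" for m n
  proof (rule ccontr)
    assume "\<not> ?thesis"
    then have "\<bar>m\<bar> \<le> R" using R by simp
    moreover have "int (den n) \<ge> int (n - 1)" using den_ge[of "n - 1"] that by (simp add: n0_def)
    ultimately show False using that by (auto simp: n0_def)
  qed
  have contra: False if n: "n \<ge> n0" and eq: "u peak = tr n * u x - u y"
    and x: "\<bar>x - peak\<bar> \<ge> int (den n)" and y: "\<bar>y - peak\<bar> \<ge> int (den n)" for n x y
  proof -
    have "\<bar>u peak\<bar> \<le> \<bar>tr n\<bar> * \<bar>u x\<bar> + \<bar>u y\<bar>"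
      unfolding eq using abs_triangle_ineq4[of "tr n * u x" "u y"] by (simp add: abs_mult)
    also have "\<bar>tr n\<bar> * \<bar>u x\<bar> \<le> C * \<epsilon>"
      using C[of n] far[OF x n] n C0 by (intro mult_mono) (auto simp: n0_def)
    also have "\<bar>u y\<bar> < \<epsilon>" using far[OF y n] .
    finally have "\<bar>u peak\<bar> < C * \<epsilon> + \<epsilon>" by simp
    also have "\<dots> \<le> (C + 2) * \<epsilon>" using \<epsilon> by (simp add: algebra_simps)
    also have "\<dots> = \<bar>u peak\<bar>" using C0 by (simp add: \<epsilon>_def)
    finally show False by simp
  qed
  show thesis
  proof (rule that[of n0])
    show "n0 \<ge> 3" by (simp add: n0_def)
  next
    fix n assume n: "n \<ge> n0"
    then have n1: "n \<ge> 1" by (simp add: n0_def)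
    show "\<exists>m. peak < m \<and> m \<le> peak + int (den n) \<and> \<not> reg \<theta> n m"
    proof (rule ccontr)
      assume "\<not> ?thesis"
      then have "u (peak + int (den n) + int (den n)) + u (peak + int (den n) - int (den n)) =
          tr n * u (peak + int (den n))"
        by (intro square n1) auto
      then show False
        using contra[OF n, of "peak + int (den n)" "peak + int (den n) + int (den n)"] by simp
    qed
    show "\<exists>m. peak - 2 * int (den n) < m \<and> m \<le> peak - int (den n) \<and> \<not> reg \<theta> n m"
    proof (rule ccontr)
      assume "\<not> ?thesis"
      then have "u (peak - int (den n) + int (den n)) + u (peak - int (den n) - int (den n)) =
          tr n * u (peak - int (den n))"
        by (intro square n1) auto
      then show False
        using contra[OF n, of "peak - int (den n)" "peak - int (den n) - int (den n)"] by simp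
    qed
  qed
qed

text \<open>The irregular positions on the two sides of the peak are less than \<open>3 * q\<close>
  apart, but a digit of at least 3 makes the gap at least \<open>3 * q\<close>.\<close>

lemma not_frequently_large_digit: "\<not> (\<exists>\<^sub>\<infinity>n. cf_digit \<alpha> (Suc n) \<ge> 3)"
proof
  assume freq: "\<exists>\<^sub>\<infinity>n. cf_digit \<alpha> (Suc n) \<ge> 3"
  obtain n0 where n0: "n0 \<ge> 3"
    and right: "\<And>n. n \<ge> n0 \<Longrightarrow> \<exists>m. peak < m \<and> m \<le> peak + int (den n) \<and> \<not> reg \<theta> n m"
    and left: "\<And>n. n \<ge> n0 \<Longrightarrow> \<exists>m. peak - 2 * int (den n) < m \<and> m \<le> peak - int (den n) \<and> \<not> reg \<theta> n m"
    using eventually_no_square by blast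
  obtain n where n: "n \<ge> n0" "cf_digit \<alpha> (Suc n) \<ge> 3"
    using freq unfolding INFM_nat_le by blast
  define q where "q = den (Suc n)"
  obtain m' where m': "peak < m'" "m' \<le> peak + int q" "\<not> reg \<theta> (Suc n) m'"
    using right[of "Suc n"] n by (auto simp: q_def)
  obtain m where m: "peak - 2 * int q < m" "m \<le> peak - int q" "\<not> reg \<theta> (Suc n) m"
    using left[of "Suc n"] n by (auto simp: q_def)
  have "m' - m \<ge> int (den (Suc (Suc n)))"
    using not_reg_gap[OF m(3) m'(3)] m m' by simp
  moreover have "den (Suc (Suc n)) \<ge> 3 * q"
    unfolding q_def using n(2) by (rule den_cf_digit_le)
  ultimately show False using m m' by linarith
qed

text \<open>If all digits are \<open>1\<close>, then the irregular position \<open>m\<^sub>n\<close> to the right of the peak satisfies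
  \<open>m\<^sub>n\<^sub>+\<^sub>1 = m\<^sub>n + q\<^sub>n\<close>, so that \<open>m\<^sub>n - q\<^sub>n\<^sub>+\<^sub>1\<close> does not depend on \<open>n\<close>, although it must tend to
  minus infinity.\<close>

lemma not_eventually_digit_one: "\<not> (\<forall>\<^sub>\<infinity>n. cf_digit \<alpha> (Suc n) = 1)"
proof
  assume "\<forall>\<^sub>\<infinity>n. cf_digit \<alpha> (Suc n) = 1"
  then obtain n1 where n1: "\<And>n. n \<ge> n1 \<Longrightarrow> cf_digit \<alpha> (Suc n) = 1"
    unfolding MOST_nat_le by blast
  obtain n0 where n0: "n0 \<ge> 3"
    and right: "\<And>n. n \<ge> n0 \<Longrightarrow> \<exists>m. peak < m \<and> m \<le> peak + int (den n) \<and> \<not> reg \<theta> n m"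
    and "\<And>n. n \<ge> n0 \<Longrightarrow> \<exists>m. peak - 2 * int (den n) < m \<and> m \<le> peak - int (den n) \<and> \<not> reg \<theta> n m"
    using eventually_no_square by blast
  define N where "N = max n0 n1"
  define b where "b n = (SOME m. peak < m \<and> m \<le> peak + int (den n) \<and> \<not> reg \<theta> n m)" for n
  have b: "peak < b n \<and> b n \<le> peak + int (den n) \<and> \<not> reg \<theta> n (b n)" if "n \<ge> n0" for n
    unfolding b_def by (rule someI_ex[OF right[OF that]])
  have shift: "b (Suc n) = b n + int (den n)" if n: "n \<ge> n0" for n
  proof -
    have *: "int (den n) \<le> int (den (Suc n))" using den_mono[of n] n n0 by simp
    have "Suc n \<ge> n0" using n by simp
    note bb = b[OF n] b[OF this]
    from bb not_reg_consecutive[of \<theta> n "b n" "b (Suc n)"]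
    have "b (Suc n) - b n \<le> - int (den (Suc n)) \<or> b (Suc n) - b n = int (den n) \<or>
        b (Suc n) - b n \<ge> int (den (Suc n)) + int (den n)"
      by blast
    \<comment> \<open>The windows to the right of the peak give
      \<open>- den n < b (n + 1) - b n < den (n + 1)\<close>, which leaves the middle
      alternative.\<close>
    then show ?thesis using bb * by linarith
  qed
  have den_rec: "int (den (Suc (Suc n))) = int (den (Suc n)) + int (den n)" if "n \<ge> N" for n
    using n1[of n] that by (simp add: N_def)
  have const: "b n - int (den (Suc n)) = b N - int (den (Suc N))" if "n \<ge> N" for n
    using that
  proof (induction n rule: dec_induct)
    case (step n)
    have "n \<ge> n0" using step.hyps by (simp add: N_def)
    from shift[OF this] den_rec[OF step.hyps(1)] step.IH show ?case by linarith
  qed simp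
  \<comment> \<open>Constancy is used at \<open>n + 2\<close>, where
    \<open>b (n + 2) \<le> peak + den (n + 2)\<close> and
    \<open>den (n + 3) - den (n + 2) = den (n + 1)\<close>.\<close>
  have low: "peak - int (den (Suc n)) \<ge> b N - int (den (Suc N))" if n: "n \<ge> N" for n
  proof -
    have "Suc (Suc n) \<ge> n0" using n by (simp add: N_def)
    moreover have "Suc n \<ge> N" "Suc (Suc n) \<ge> N" using n by auto
    ultimately show ?thesis
      using b[of "Suc (Suc n)"] const[of "Suc (Suc n)"] den_rec[of "Suc n"] by linarith
  qed
  define K where "K = nat (\<bar>peak - b N + int (den (Suc N))\<bar> + 1) + N"
  have "int K \<le> int (den (Suc K))" using den_ge[of K] by simp
  moreover have "int K \<ge> \<bar>peak - b N + int (den (Suc N))\<bar> + 1" by (simp add: K_def)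
  moreover have "peak - int (den (Suc K)) \<ge> b N - int (den (Suc N))"
    by (rule low) (simp add: K_def)
  ultimately show False by linarith
qed

lemma limsup_cf_digit: "limsup (\<lambda>n. ereal (real (cf_digit \<alpha> (Suc n)))) = 2"
proof (rule antisym)
  have two: "(2 :: ereal) = ereal 2" by simp
  have "\<forall>\<^sub>\<infinity>n. \<not> cf_digit \<alpha> (Suc n) \<ge> 3"
    using not_frequently_large_digit unfolding not_frequently .
  then have "\<forall>\<^sub>F n in sequentially. ereal (real (cf_digit \<alpha> (Suc n))) \<le> 2"
    unfolding cofinite_eq_sequentially
  proof eventually_elim
    case (elim n)
    then have "real (cf_digit \<alpha> (Suc n)) \<le> 2" by simp
    then show ?case unfolding two by simp
  qed
  then show "limsup (\<lambda>n. ereal (real (cf_digit \<alpha> (Suc n)))) \<le> 2"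
    by (rule Limsup_bounded)
  show "2 \<le> limsup (\<lambda>n. ereal (real (cf_digit \<alpha> (Suc n))))"
  proof (rule ccontr)
    assume "\<not> ?thesis"
    then have "\<forall>\<^sub>F n in sequentially. ereal (real (cf_digit \<alpha> (Suc n))) < 2"
      by (intro Limsup_lessD) simp
    then have "\<forall>\<^sub>\<infinity>n. cf_digit \<alpha> (Suc n) = 1"
      unfolding cofinite_eq_sequentially
    proof eventually_elim
      case (elim n)
      then have "real (cf_digit \<alpha> (Suc n)) < 2" unfolding two by simp
      then show ?case using cf_digit_ge_1[of n] by simp
    qed
    then show False using not_eventually_digit_one by simp
  qed
qed

end

section \<open>Reduction to real energies and real solutions\<close>

lemma finite_norm_ge_of_square_summable:
  fixes u :: "'a \<Rightarrow> 'b::real_normed_vector"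
  assumes sum: "(\<lambda>n. (norm (u n))\<^sup>2) summable_on UNIV" and \<epsilon>: "\<epsilon> > 0"
  shows "finite {n. norm (u n) \<ge> \<epsilon>}"
proof (rule ccontr)
  define S where "S = infsum (\<lambda>n. (norm (u n))\<^sup>2) UNIV"
  assume "infinite {n. norm (u n) \<ge> \<epsilon>}"
  obtain k :: nat where k: "S < real k * \<epsilon>\<^sup>2"
    using \<epsilon> reals_Archimedean3[of "\<epsilon>\<^sup>2"] by auto
  obtain B where B: "finite B" "card B = k" "B \<subseteq> {n. norm (u n) \<ge> \<epsilon>}"
    using infinite_arbitrarily_large[OF \<open>infinite _\<close>] by blast
  have "real k * \<epsilon>\<^sup>2 = (\<Sum>n\<in>B. \<epsilon>\<^sup>2)" using B by simp
  also have "\<dots> \<le> (\<Sum>n\<in>B. (norm (u n))\<^sup>2)"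
    using B(3) \<epsilon> by (intro sum_mono power_mono) auto
  also have "\<dots> \<le> S"
    unfolding S_def using B(1) sum by (intro finite_sum_le_infsum) auto
  finally show False using k by simp
qed

lemma tendsto_zero_of_finite_norm_ge:
  fixes u :: "int \<Rightarrow> complex" and g :: "nat \<Rightarrow> int"
  assumes "\<And>\<epsilon>. \<epsilon> > 0 \<Longrightarrow> finite {n. norm (u n) \<ge> \<epsilon>}" "inj g"
  shows "(\<lambda>k. u (g k)) \<longlonglongrightarrow> 0"
proof (rule tendstoI)
  fix \<epsilon> :: real assume "\<epsilon> > 0"
  then have "finite (g -` {n. norm (u n) \<ge> \<epsilon>})"
    using assms by (intro finite_vimageI)
  then show "\<forall>\<^sub>F k in sequentially. dist (u (g k)) 0 < \<epsilon>"
    by (simp add: vimage_def eventually_cofinite not_less flip: cofinite_eq_sequentially)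
qed

text \<open>The current \<open>Im (cnj (u n) * u (n + 1))\<close> is monotone in \<open>n\<close> up to the sign of \<open>Im E\<close> and
  vanishes at both ends, so that \<open>E\<close> is real.\<close>

lemma eigenvalue_real:
  fixes u :: "int \<Rightarrow> complex" and V :: "int \<Rightarrow> real"
  assumes sol: "\<And>n. u (n + 1) + u (n - 1) + complex_of_real (V n) * u n = E * u n"
    and decay: "\<And>\<epsilon>. \<epsilon> > 0 \<Longrightarrow> finite {n. norm (u n) \<ge> \<epsilon>}"
    and nonzero: "u n0 \<noteq> 0"
  shows "Im E = 0"
proof (rule ccontr)
  assume E: "Im E \<noteq> 0"
  \<comment> \<open>The factor \<open>Im E\<close> makes \<open>J\<close> nondecreasing for either
    sign of \<open>Im E\<close>.\<close>
  define J where "J n = Im E * Im (cnj (u n) * u (n + 1))" for n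
  have J: "J n - J (n - 1) = (Im E)\<^sup>2 * (norm (u n))\<^sup>2" for n
  proof -
    have "Im (cnj (u n) * (u (n + 1) + u (n - 1) + complex_of_real (V n) * u n)) =
        Im (cnj (u n) * (E * u n))"
      by (simp only: sol)
    then have "Im (cnj (u n) * u (n + 1)) - Im (cnj (u (n - 1)) * u n) = Im E * (norm (u n))\<^sup>2"
      unfolding cmod_power2 by (simp add: power2_eq_square algebra_simps)
    then show ?thesis
      unfolding J_def by (simp add: power2_eq_square mult.assoc flip: right_diff_distrib)
  qed
  have mono: "J n \<le> J m" if "n \<le> m" for n m
    using that
  proof (induction m rule: int_ge_induct)
    case (step m)
    have "J (m + 1) - J m \<ge> 0" using J[of "m + 1"] by simp
    with step show ?case by linarith
  qed simp
  have lim: "(\<lambda>k. J (g k)) \<longlonglongrightarrow> 0" if "inj g" for g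
  proof -
    have u: "(\<lambda>k. u (g k)) \<longlonglongrightarrow> 0" "(\<lambda>k. u (g k + 1)) \<longlonglongrightarrow> 0"
      using tendsto_zero_of_finite_norm_ge[OF decay, of g]
        tendsto_zero_of_finite_norm_ge[OF decay, of "\<lambda>k. g k + 1"] that
      by (auto simp: inj_def)
    have "(\<lambda>k. Im E * Im (cnj (u (g k)) * u (g k + 1))) \<longlonglongrightarrow> Im E * Im (cnj 0 * 0)"
      by (intro tendsto_intros u)
    then show ?thesis by (simp add: J_def)
  qed
  have "J n = 0" for n
  proof (rule antisym)
    show "J n \<le> 0"
      by (rule LIMSEQ_le_const[OF lim[of "\<lambda>k. n + int k"]]) (auto simp: inj_def intro!: mono)
    show "0 \<le> J n"
      by (rule LIMSEQ_le_const2[OF lim[of "\<lambda>k. n - int k"]]) (auto simp: inj_def intro!: mono)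
  qed
  with J[of n0] E nonzero show False by simp
qed

theorem theorem1:
  fixes \<alpha> :: real
  assumes "0 < \<alpha>" "\<alpha> < 1" "\<alpha> \<notin> \<rat>"
    and "limsup (\<lambda>n. ereal (real (cf_digit \<alpha> (Suc n)))) \<noteq> 2"
  shows "\<forall>lam :: real. \<forall>\<theta> :: real. lam \<noteq> 0 \<longrightarrow> 0 \<le> \<theta> \<longrightarrow> \<theta> < 1 \<longrightarrow>
           (\<forall>E. \<not> is_eigenvalue_sturmian lam \<alpha> \<theta> E)"
proof (intro allI impI notI)
  fix lam \<theta> :: real and E :: complex
  assume "is_eigenvalue_sturmian lam \<alpha> \<theta> E"
  then obtain u :: "int \<Rightarrow> complex" where
    summable: "(\<lambda>n. (norm (u n))\<^sup>2) summable_on UNIV" and nonzero: "u \<noteq> (\<lambda>_. 0)" and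
    sol: "\<And>n. u (n + 1) + u (n - 1) + complex_of_real (lam * sturmian \<alpha> \<theta> n) * u n = E * u n"
    unfolding is_eigenvalue_sturmian_def by blast
  have decay: "finite {n. norm (u n) \<ge> \<epsilon>}" if "\<epsilon> > 0" for \<epsilon>
    using summable that by (rule finite_norm_ge_of_square_summable)
  obtain n0 where n0: "u n0 \<noteq> 0" using nonzero by auto
  have E: "E = complex_of_real (Re E)"
    using eigenvalue_real[OF sol decay n0] by (simp add: complex_eq_iff)
  \<comment> \<open>For real energy the real and imaginary parts of \<open>u\<close> are solutions
    dominated by \<open>norm (u n)\<close>, and one of them is nonzero at \<open>n0\<close>.\<close>
  have contra: False if v: "\<And>n. \<bar>v n\<bar> \<le> norm (u n)" "v n0 \<noteq> 0"
    "schrodinger (Re E) (\<lambda>j. lam * sturmian \<alpha> \<theta> j) v" for v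
  proof -
    interpret sturmian_solution \<alpha> "Re E" lam \<theta> v
    proof
      show "finite {n. \<bar>v n\<bar> \<ge> \<epsilon>}" if "\<epsilon> > 0" for \<epsilon>
        using decay[OF that] by (rule finite_subset[rotated]) (auto intro: order_trans[OF _ v(1)])
    qed (use assms v in auto)
    show False using limsup_cf_digit assms(4) by simp
  qed
  have sol': "u (n + 1) + u (n - 1) + complex_of_real (lam * sturmian \<alpha> \<theta> n) * u n =
      complex_of_real (Re E) * u n" for n
    using sol[of n] E by simp
  have "schrodinger (Re E) (\<lambda>j. lam * sturmian \<alpha> \<theta> j) (\<lambda>n. Re (u n))"
    unfolding schrodinger_def using sol'[THEN arg_cong[of _ _ Re]] by simp
  moreover have "schrodinger (Re E) (\<lambda>j. lam * sturmian \<alpha> \<theta> j) (\<lambda>n. Im (u n))"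
    unfolding schrodinger_def using sol'[THEN arg_cong[of _ _ Im]] by simp
  moreover have "Re (u n0) \<noteq> 0 \<or> Im (u n0) \<noteq> 0"
    using n0 by (simp add: complex_eq_iff)
  ultimately show False
    using contra[of "\<lambda>n. Re (u n)"] contra[of "\<lambda>n. Im (u n)"] abs_Re_le_cmod abs_Im_le_cmod by blast
qed

end
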